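(* Let $V$ be a finite-dimensional complex vector space with basis $e_1,\dots,e_n$, and let $(M^{ab}, M_{ab}, R, \overline{R})$ be an unoriented quantum state model (as defined in the context) whose crossing operator is of product form $R=F\otimes G$ with $F,G\in GL(V)$. Let $s\in\mathbb{C}\setminus\{0\}$ be the scalar with $R=s\,I_{V\otimes V}$, let $\langle K\rangle$ be the state sum of a diagram $K$, and put $f_K=s^{-w(K)}\langle K\rangle$, where $w(K)$ is the writhe of $K$. Then $f$ is a trivial invariant of knots: for every diagram $K$ of any knot (one-component link), $f_K=f_O$, where $O$ is the crossingless diagram of the unknot (a circle).
   Context: A Morse diagram is a link diagram in the plane in general position with respect to the vertical direction, so that it decomposes into minima (cups), maxima (caps) and crossings; every link diagram can be put in this form by a planar isotopy. An unoriented quantum state model consists of complex numbers $M^{ab}$ (attached to minima with upper left and upper right endpoints labelled $a,b$), $M_{ab}$ (attached to maxima with lower left and lower right endpoints $a,b$), an invertible operator $R$ on $V\otimes V$ with inverse $\overline R$ and entries given by $R(e_a\otimes e_b)=\sum_{c,d} R^{ab}_{cd}\,e_c\otimes e_d$, and similarly $\overline{R}^{ab}_{cd}$. At a crossing, $a,b$ label the upper left and upper right endpoints and $c,d$ the lower left and lower right endpoints; $R$ is attached to crossings whose overcrossing strand runs from upper left to lower right, and $\overline R$ to the other type of crossing. The following equations (repeated indices summed) are required: 1. $M_{ai}M^{ib}=\delta_a^b=M^{bi}M_{ia}$; 2. $\overline{R}^{ab}_{ij}R^{ij}_{cd}=\delta^a_c\delta^b_d=R^{ab}_{ij}\overline{R}^{ij}_{cd}$;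 3. the Yang-Baxter equation $(R\otimes I)(I\otimes R)(R\otimes I)=(I\otimes R)(R\otimes I)(I\otimes R)$; 4. $M^{di}\,\overline{R}^{ab}_{ic}=R^{da}_{ci}\,M^{ib}$ and $M_{di}\,\overline{R}^{ic}_{ab}=R^{ci}_{da}\,M_{ib}$, together with the same two equations with $R$ and $\overline{R}$ interchanged. The state sum $\langle K\rangle$ of a Morse diagram $K$ is obtained by labelling the endpoints of all cups, caps and crossings by indices in $\{1,\dots,n\}$ (joined endpoints receiving the same label), taking the product of the corresponding entries, and summing over all labellings. Equations 1-4 make it an invariant of regular isotopy (the equivalence relation generated by planar isotopy and the second and third Reidemeister moves). When $R=F\otimes G$ with $F,G$ invertible, the Yang-Baxter equation forces $F$ and $G$ to be scalar multiples of the identity, so $R=s\,I$ for a nonzero scalar $s$. The writhe $w(K)$ of a knot diagram is the sum of the signs of its crossings with respect to an orientation (it does not depend on the orientation); a crossing with both strands oriented upward is positive if its overcrossing strand runs from lower left to upper right, and negative otherwise. *)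

theory Defs
  imports "HOL-Analysis.Analysis"
begin

section \<open>Unoriented quantum state models\<close>

text \<open>
  \<open>V\<close> is identified with \<open>complex ^ 'n\<close> through its basis, \<open>V \<otimes> V\<close> with \<open>complex ^ ('n \<times> 'n)\<close>
  through the basis \<open>e\<^sub>a \<otimes> e\<^sub>b\<close>, and operators with their matrices.  The columns of a matrix are
  the images of the basis vectors, so \<open>R(e\<^sub>a \<otimes> e\<^sub>b) = (\<Sum>c d. R\<^sup>a\<^sup>b\<^sub>c\<^sub>d e\<^sub>c \<otimes> e\<^sub>d)\<close> puts the upper
  indices \<open>a, b\<close> in the column and the lower indices \<open>c, d\<close> in the row.
\<close>

definition entry :: "complex ^ ('n::finite \<times> 'n) ^ ('n \<times> 'n) \<Rightarrow> 'n \<Rightarrow> 'n \<Rightarrow> 'n \<Rightarrow> 'n \<Rightarrow> complex" where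
  "entry R a b c d = R $ (c, d) $ (a, b)"

definition tensor_op ::
    "complex ^ ('n::finite) ^ 'n \<Rightarrow> complex ^ 'n ^ 'n \<Rightarrow> complex ^ ('n \<times> 'n) ^ ('n \<times> 'n)" where
  "tensor_op F G = (\<chi> p q. F $ fst p $ fst q * G $ snd p $ snd q)"

definition op_tensor_id ::
    "complex ^ ('n::finite \<times> 'n) ^ ('n \<times> 'n) \<Rightarrow> complex ^ ('n \<times> 'n \<times> 'n) ^ ('n \<times> 'n \<times> 'n)" where
  "op_tensor_id R = (\<chi> p q. case (p, q) of ((c1, c2, c3), (a1, a2, a3)) \<Rightarrow>
     R $ (c1, c2) $ (a1, a2) * of_bool (c3 = a3))"

definition id_tensor_op ::
    "complex ^ ('n::finite \<times> 'n) ^ ('n \<times> 'n) \<Rightarrow> complex ^ ('n \<times> 'n \<times> 'n) ^ ('n \<times> 'n \<times> 'n)" where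
  "id_tensor_op R = (\<chi> p q. case (p, q) of ((c1, c2, c3), (a1, a2, a3)) \<Rightarrow>
     of_bool (c1 = a1) * R $ (c2, c3) $ (a2, a3))"

definition yang_baxter :: "complex ^ ('n::finite \<times> 'n) ^ ('n \<times> 'n) \<Rightarrow> bool" where
  "yang_baxter R \<longleftrightarrow>
     op_tensor_id R ** id_tensor_op R ** op_tensor_id R =
     id_tensor_op R ** op_tensor_id R ** id_tensor_op R"

text \<open>\<open>Mu a b\<close> is \<open>M\<^sup>a\<^sup>b\<close> (minima) and \<open>Md a b\<close> is \<open>M\<^sub>a\<^sub>b\<close> (maxima).\<close>

definition slide_equations ::
    "('n::finite \<Rightarrow> 'n \<Rightarrow> complex) \<Rightarrow> ('n \<Rightarrow> 'n \<Rightarrow> complex) \<Rightarrow>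
     complex ^ ('n \<times> 'n) ^ ('n \<times> 'n) \<Rightarrow> complex ^ ('n \<times> 'n) ^ ('n \<times> 'n) \<Rightarrow> bool" where
  "slide_equations Mu Md R Rbar \<longleftrightarrow>
     (\<forall>a b c d. (\<Sum>i\<in>UNIV. Mu d i * entry Rbar a b i c) = (\<Sum>i\<in>UNIV. entry R d a c i * Mu i b)) \<and>
     (\<forall>a b c d. (\<Sum>i\<in>UNIV. Md d i * entry Rbar i c a b) = (\<Sum>i\<in>UNIV. entry R c i d a * Md i b))"

definition quantum_state_model ::
    "('n::finite \<Rightarrow> 'n \<Rightarrow> complex) \<Rightarrow> ('n \<Rightarrow> 'n \<Rightarrow> complex) \<Rightarrow>
     complex ^ ('n \<times> 'n) ^ ('n \<times> 'n) \<Rightarrow> complex ^ ('n \<times> 'n) ^ ('n \<times> 'n) \<Rightarrow> bool" where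
  "quantum_state_model Mu Md R Rbar \<longleftrightarrow>
     (\<forall>a b. (\<Sum>i\<in>UNIV. Md a i * Mu i b) = of_bool (a = b) \<and>
            (\<Sum>i\<in>UNIV. Mu b i * Md i a) = of_bool (a = b)) \<and>
     (\<forall>a b c d.
        (\<Sum>i\<in>UNIV. \<Sum>j\<in>UNIV. entry Rbar a b i j * entry R i j c d) = of_bool (a = c \<and> b = d) \<and>
        (\<Sum>i\<in>UNIV. \<Sum>j\<in>UNIV. entry R a b i j * entry Rbar i j c d) = of_bool (a = c \<and> b = d)) \<and>
     yang_baxter R \<and>
     slide_equations Mu Md R Rbar \<and>
     slide_equations Mu Md Rbar R"

section \<open>Morse diagrams\<close>

text \<open>
  A Morse diagram in general position has its minima, maxima and crossings at different heights.
  It is recorded as the list of these events from bottom to top; the argument of an event is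
  the number of strands to its left.  \<open>Cross_R\<close> is a crossing whose overcrossing strand runs from
  upper left to lower right, \<open>Cross_Rbar\<close> one whose overcrossing strand runs from lower left to
  upper right.
\<close>

datatype event = Cup nat | Cap nat | Cross_R nat | Cross_Rbar nat

fun event_ok :: "event \<Rightarrow> nat \<Rightarrow> bool" where
  "event_ok (Cup p) w \<longleftrightarrow> p \<le> w"
| "event_ok (Cap p) w \<longleftrightarrow> p + 2 \<le> w"
| "event_ok (Cross_R p) w \<longleftrightarrow> p + 2 \<le> w"
| "event_ok (Cross_Rbar p) w \<longleftrightarrow> p + 2 \<le> w"

fun width_above :: "event \<Rightarrow> nat \<Rightarrow> nat" where
  "width_above (Cup p) w = w + 2"
| "width_above (Cap p) w = w - 2"
| "width_above (Cross_R p) w = w"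
| "width_above (Cross_Rbar p) w = w"

text \<open>Event number \<open>t\<close> (counted from 0) lies between the horizontal levels \<open>t\<close> and \<open>t + 1\<close>.\<close>

definition width :: "event list \<Rightarrow> nat \<Rightarrow> nat" where
  "width D t = fold width_above (take t D) 0"

definition morse_diagram :: "event list \<Rightarrow> bool" where
  "morse_diagram D \<longleftrightarrow>
     (\<forall>t < length D. event_ok (D ! t) (width D t)) \<and> width D (length D) = 0"

text \<open>The point \<open>(t, i)\<close> is the intersection of level \<open>t\<close> with its \<open>i\<close>-th strand from the left.\<close>

definition points :: "event list \<Rightarrow> (nat \<times> nat) set" where
  "points D = {(t, i). t \<le> length D \<and> i < width D t}"

text \<open>
  \<open>bypasses e i j\<close>: strand \<open>i\<close> below the event \<open>e\<close> continues, without meeting the event, as strand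
  \<open>j\<close> above it.  \<open>crosses e i j\<close>: it runs through the crossing \<open>e\<close> and continues as strand \<open>j\<close>.
\<close>

fun bypasses :: "event \<Rightarrow> nat \<Rightarrow> nat \<Rightarrow> bool" where
  "bypasses (Cup p) i j \<longleftrightarrow> (i < p \<and> j = i) \<or> (p \<le> i \<and> j = i + 2)"
| "bypasses (Cap p) i j \<longleftrightarrow> (i < p \<and> j = i) \<or> (p + 2 \<le> i \<and> i = j + 2)"
| "bypasses (Cross_R p) i j \<longleftrightarrow> i \<noteq> p \<and> i \<noteq> p + 1 \<and> j = i"
| "bypasses (Cross_Rbar p) i j \<longleftrightarrow> i \<noteq> p \<and> i \<noteq> p + 1 \<and> j = i"

fun crosses :: "event \<Rightarrow> nat \<Rightarrow> nat \<Rightarrow> bool" where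
  "crosses (Cup p) i j \<longleftrightarrow> False"
| "crosses (Cap p) i j \<longleftrightarrow> False"
| "crosses (Cross_R p) i j \<longleftrightarrow> (i = p \<and> j = p + 1) \<or> (i = p + 1 \<and> j = p)"
| "crosses (Cross_Rbar p) i j \<longleftrightarrow> (i = p \<and> j = p + 1) \<or> (i = p + 1 \<and> j = p)"

definition bypass_joins :: "event list \<Rightarrow> ((nat \<times> nat) \<times> (nat \<times> nat)) set" where
  "bypass_joins D =
     {((t, i), (Suc t, j)) | t i j.
        t < length D \<and> i < width D t \<and> j < width D (Suc t) \<and> bypasses (D ! t) i j}"

definition crossing_joins :: "event list \<Rightarrow> ((nat \<times> nat) \<times> (nat \<times> nat)) set" where
  "crossing_joins D = {((t, i), (Suc t, j)) | t i j. t < length D \<and> crosses (D ! t) i j}"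

definition turn_joins :: "event list \<Rightarrow> ((nat \<times> nat) \<times> (nat \<times> nat)) set" where
  "turn_joins D =
     {((Suc t, p), (Suc t, Suc p)) | t p. t < length D \<and> D ! t = Cup p} \<union>
     {((t, p), (t, Suc p)) | t p. t < length D \<and> D ! t = Cap p}"

text \<open>
  A knot diagram has exactly one component: it is nonempty, and any two of its points can be
  connected by travelling along the strands.
\<close>

definition knot_diagram :: "event list \<Rightarrow> bool" where
  "knot_diagram D \<longleftrightarrow>
     morse_diagram D \<and> points D \<noteq> {} \<and>
     (let E = bypass_joins D \<union> crossing_joins D \<union> turn_joins D
      in \<forall>x \<in> points D. \<forall>y \<in> points D. (x, y) \<in> (E \<union> E\<inverse>)\<^sup>*)"

definition circle_diagram :: "event list" where
  "circle_diagram = [Cup 0, Cap 0]"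

section \<open>The state sum\<close>

text \<open>
  The endpoints of the events are among the points of the diagram, and every point lies on a
  vertical segment between two such endpoints.  Labelling all points, with equal labels along
  vertical segments, is therefore the same as labelling the endpoints of the events, with equal
  labels for joined endpoints.
\<close>

definition labellings :: "event list \<Rightarrow> (nat \<times> nat \<Rightarrow> 'n) set" where
  "labellings D =
     {\<sigma> \<in> points D \<rightarrow>\<^sub>E UNIV. \<forall>(x, y) \<in> bypass_joins D. \<sigma> x = \<sigma> y}"

fun event_weight ::
    "('n::finite \<Rightarrow> 'n \<Rightarrow> complex) \<Rightarrow> ('n \<Rightarrow> 'n \<Rightarrow> complex) \<Rightarrow>
     complex ^ ('n \<times> 'n) ^ ('n \<times> 'n) \<Rightarrow> complex ^ ('n \<times> 'n) ^ ('n \<times> 'n) \<Rightarrow>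
     (nat \<times> nat \<Rightarrow> 'n) \<Rightarrow> nat \<Rightarrow> event \<Rightarrow> complex" where
  "event_weight Mu Md R Rbar \<sigma> t (Cup p) = Mu (\<sigma> (Suc t, p)) (\<sigma> (Suc t, Suc p))"
| "event_weight Mu Md R Rbar \<sigma> t (Cap p) = Md (\<sigma> (t, p)) (\<sigma> (t, Suc p))"
| "event_weight Mu Md R Rbar \<sigma> t (Cross_R p) =
     entry R (\<sigma> (Suc t, p)) (\<sigma> (Suc t, Suc p)) (\<sigma> (t, p)) (\<sigma> (t, Suc p))"
| "event_weight Mu Md R Rbar \<sigma> t (Cross_Rbar p) =
     entry Rbar (\<sigma> (Suc t, p)) (\<sigma> (Suc t, Suc p)) (\<sigma> (t, p)) (\<sigma> (t, Suc p))"

definition state_sum ::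
    "('n::finite \<Rightarrow> 'n \<Rightarrow> complex) \<Rightarrow> ('n \<Rightarrow> 'n \<Rightarrow> complex) \<Rightarrow>
     complex ^ ('n \<times> 'n) ^ ('n \<times> 'n) \<Rightarrow> complex ^ ('n \<times> 'n) ^ ('n \<times> 'n) \<Rightarrow>
     event list \<Rightarrow> complex" where
  "state_sum Mu Md R Rbar D =
     (\<Sum>\<sigma> \<in> labellings D. \<Prod>t < length D. event_weight Mu Md R Rbar \<sigma> t (D ! t))"

section \<open>Writhe\<close>

text \<open>An orientation tells for every point whether the strand through it is directed upward.\<close>

definition orientation :: "event list \<Rightarrow> (nat \<times> nat \<Rightarrow> bool) \<Rightarrow> bool" where
  "orientation D up \<longleftrightarrow>
     (\<forall>(x, y) \<in> bypass_joins D \<union> crossing_joins D. up x = up y) \<and>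
     (\<forall>(x, y) \<in> turn_joins D. up x \<noteq> up y)"

text \<open>
  With both strands upward, \<open>Cross_Rbar\<close> is positive and \<open>Cross_R\<close> negative.  Reversing one of
  the two strands changes the sign, reversing both does not.
\<close>

fun crossing_sign :: "(nat \<times> nat \<Rightarrow> bool) \<Rightarrow> nat \<Rightarrow> event \<Rightarrow> int" where
  "crossing_sign up t (Cup p) = 0"
| "crossing_sign up t (Cap p) = 0"
| "crossing_sign up t (Cross_R p) = (if up (t, p) = up (t, Suc p) then - 1 else 1)"
| "crossing_sign up t (Cross_Rbar p) = (if up (t, p) = up (t, Suc p) then 1 else - 1)"

definition writhe :: "event list \<Rightarrow> (nat \<times> nat \<Rightarrow> bool) \<Rightarrow> int" where
  "writhe D up = (\<Sum>t < length D. crossing_sign up t (D ! t))"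

definition normalized_state_sum ::
    "complex \<Rightarrow> ('n::finite \<Rightarrow> 'n \<Rightarrow> complex) \<Rightarrow> ('n \<Rightarrow> 'n \<Rightarrow> complex) \<Rightarrow>
     complex ^ ('n \<times> 'n) ^ ('n \<times> 'n) \<Rightarrow> complex ^ ('n \<times> 'n) ^ ('n \<times> 'n) \<Rightarrow>
     event list \<Rightarrow> (nat \<times> nat \<Rightarrow> bool) \<Rightarrow> complex" where
  "normalized_state_sum s Mu Md R Rbar D up =
     s powi (- writhe D up) * state_sum Mu Md R Rbar D"

end

theory Submission
  imports Defs
begin

text \<open>
  A scalar crossing operator is so restrictive that the state model collapses.  Graphically,
  \<open>R = s I\<close> replaces a crossing by two parallel vertical strands, and the slide equations then
  compare two different planar connections of four endpoints:
  \<open>s\<inverse> M\<^sup>d\<^sup>a \<delta>\<^sup>b\<^sub>c = s \<delta>\<^sup>d\<^sub>c M\<^sup>a\<^sup>b\<close>.  If there were two different indices, the choice \<open>b = c \<noteq> d\<close>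
  would kill the whole row \<open>d\<close> of the invertible matrix \<open>M\<^sup>a\<^sup>b\<close>.  Hence \<open>V\<close> is one-dimensional
  (\<open>scalar_model_one_dimensional\<close>), and the same equation with all indices equal gives \<open>s\<^sup>2 = 1\<close>
  (\<open>scalar_model_values\<close>).

  In dimension one a diagram has a single labelling, and its state sum is a plain product: \<open>m\<close> for
  each minimum, \<open>m\<inverse>\<close> for each maximum and \<open>s\<close> for each crossing.  As \<open>s = s\<inverse>\<close>, the factor
  \<open>s\<^sup>-\<^sup>w\<close> contributes another \<open>s\<close> per crossing, whatever its sign, and cancels all crossings.
  What remains is \<open>m\<close> to the power \<open>minima - maxima\<close>.  This difference is half the number of
  strands at the top level of the diagram, which is zero.  So the normalized state sum of every
  Morse diagram is 1 (\<open>normalized_state_sum_one_dimensional\<close>); in particular the circle and any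
  knot diagram have the same value.
\<close>

lemma entry_mat: "entry (mat s) a b c d = (if a = c \<and> b = d then s else 0)"
  by (auto simp: entry_def mat_def)

lemma sum_entry_scalar:
  fixes c d :: "'n::finite"
  shows "(\<Sum>i\<in>UNIV. \<Sum>j\<in>UNIV. f i j * (if i = c \<and> j = d then s else 0)) = f c d * (s::complex)"
proof -
  have "(\<Sum>j\<in>UNIV. f i j * (if i = c \<and> j = d then s else 0)) = (if i = c then f c d * s else 0)"
    for i
    by (cases "i = c") (simp_all add: if_distrib cong: if_cong)
  then show ?thesis
    by simp
qed

lemma scalar_model_inverse_entry:
  assumes "quantum_state_model Mu Md (mat s) Rbar" and "s \<noteq> 0"
  shows "entry Rbar a b c d = (if a = c \<and> b = d then inverse s else 0)"
proof -
  have "(\<Sum>i\<in>UNIV. \<Sum>j\<in>UNIV. entry Rbar a b i j * entry (mat s) i j c d)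
      = of_bool (a = c \<and> b = d)"
    using assms(1) unfolding quantum_state_model_def by blast
  then have "entry Rbar a b c d * s = of_bool (a = c \<and> b = d)"
    by (simp add: entry_mat sum_entry_scalar)
  with \<open>s \<noteq> 0\<close> show ?thesis
    by (auto simp: field_simps split: if_splits)
qed

text \<open>
  With the crossing replaced by vertical strands, the minimum on the left-hand side of the slide
  equation is attached to the left strand, so it joins \<open>d\<close> with \<open>a\<close> and leaves \<open>b\<close> straight above
  \<open>c\<close>; on the right-hand side it is attached to the right strand, so it joins \<open>a\<close> with \<open>b\<close> and
  leaves \<open>d\<close> straight above \<open>c\<close>.
\<close>

lemma scalar_model_slide:
  assumes "quantum_state_model Mu Md (mat s) Rbar" and "s \<noteq> 0"
  shows "Mu d a * (if b = c then inverse s else 0) = (if d = c then s else 0) * Mu a b"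
proof -
  have "slide_equations Mu Md (mat s) Rbar"
    using assms(1) unfolding quantum_state_model_def by blast
  then have "(\<Sum>i\<in>UNIV. Mu d i * entry Rbar a b i c)
      = (\<Sum>i\<in>UNIV. entry (mat s) d a c i * Mu i b)"
    unfolding slide_equations_def by blast
  moreover have "(\<Sum>i\<in>UNIV. Mu d i * entry Rbar a b i c)
      = Mu d a * (if b = c then inverse s else 0)"
    unfolding scalar_model_inverse_entry[OF assms]
    by (cases "b = c") (simp_all add: if_distrib cong: if_cong)
  moreover have "(\<Sum>i\<in>UNIV. entry (mat s) d a c i * Mu i b)
      = (if d = c then s else 0) * Mu a b"
    unfolding entry_mat
    by (cases "d = c") (simp_all add: if_distribR if_distrib[of "\<lambda>x. x * _"] cong: if_cong)
  ultimately show ?thesis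
    by simp
qed

lemma scalar_model_one_dimensional:
  fixes Mu Md :: "'n::finite \<Rightarrow> 'n \<Rightarrow> complex" and x y :: 'n
  assumes "quantum_state_model Mu Md (mat s) Rbar" and "s \<noteq> 0"
  shows "x = y"
proof (rule ccontr)
  assume "x \<noteq> y"
  then have "Mu x i = 0" for i
    using scalar_model_slide[OF assms, of x i y y] \<open>s \<noteq> 0\<close> by simp
  then have "(\<Sum>i\<in>UNIV. Mu x i * Md i x) = 0"
    by simp
  moreover have "(\<Sum>i\<in>UNIV. Mu x i * Md i x) = of_bool (x = x)"
    using assms(1) unfolding quantum_state_model_def by blast
  ultimately show False
    by simp
qed

lemma scalar_model_values:
  assumes "quantum_state_model Mu Md (mat s) Rbar" and "s \<noteq> 0"
  shows "Mu x x * Md x x = 1" and "s * s = 1" and "entry Rbar x x x x = s"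
proof -
  have "UNIV = {x}"
    using scalar_model_one_dimensional[OF assms] by blast
  moreover have "(\<Sum>i\<in>UNIV. Mu x i * Md i x) = of_bool (x = x)"
    using assms(1) unfolding quantum_state_model_def by blast
  ultimately have "(\<Sum>i\<in>{x}. Mu x i * Md i x) = 1"
    by simp
  then show m: "Mu x x * Md x x = 1"
    by simp
  then have "Mu x x \<noteq> 0"
    by auto
  then show s: "s * s = 1"
    using scalar_model_slide[OF assms, of x x x x] \<open>s \<noteq> 0\<close> by (simp add: field_simps)
  then show "entry Rbar x x x x = s"
    using \<open>s \<noteq> 0\<close> by (simp add: scalar_model_inverse_entry[OF assms] field_simps)
qed

lemma labellings_one_dimensional:
  fixes x :: 'n
  assumes "\<And>y :: 'n. y = x"
  shows "labellings D = {\<lambda>q \<in> points D. x}"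
proof -
  have "\<sigma> = (\<lambda>q \<in> points D. x)" if "\<sigma> \<in> labellings D" for \<sigma> :: "nat \<times> nat \<Rightarrow> 'n"
  proof (rule PiE_ext)
    show "\<sigma> \<in> points D \<rightarrow>\<^sub>E UNIV"
      using that by (simp add: labellings_def)
  qed (auto simp: assms)
  moreover have "(\<lambda>q \<in> points D. x) \<in> labellings D"
    by (auto simp: labellings_def bypass_joins_def points_def)
  ultimately show ?thesis
    by blast
qed

lemma width_Suc:
  assumes "t < length D"
  shows "width D (Suc t) = width_above (D ! t) (width D t)"
  using assms by (simp add: width_def take_Suc_conv_app_nth)

text \<open>
  The partial product below a level is determined by the number of strands at that level: each
  minimum still waiting for its maximum accounts for two of them.  This is the invariant that
  makes minima and maxima cancel without counting them separately.
\<close>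

lemma normalized_product_below_level:
  fixes \<sigma> :: "nat \<times> nat \<Rightarrow> 'n::finite"
  assumes "quantum_state_model Mu Md (mat s) Rbar" and "s \<noteq> 0"
    and ok: "\<forall>t < length D. event_ok (D ! t) (width D t)"
    and "k \<le> length D"
  shows "s powi (- (\<Sum>t<k. crossing_sign up t (D ! t))) *
         (\<Prod>t<k. event_weight Mu Md (mat s) Rbar \<sigma> t (D ! t)) = Mu x x ^ (width D k div 2)"
  using \<open>k \<le> length D\<close>
proof (induction k)
  case 0
  show ?case
    by (simp add: width_def)
next
  case (Suc k)
  then have k: "k < length D"
    by simp
  have label: "\<sigma> q = x" for q
    by (rule scalar_model_one_dimensional[OF assms(1,2)])
  note vals = scalar_model_values[OF assms(1,2)]
  have inv_s: "inverse s = s"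
    using vals(2) by (rule inverse_unique)
  have weights: "event_weight Mu Md (mat s) Rbar \<sigma> k e =
      (case e of Cup _ \<Rightarrow> Mu x x | Cap _ \<Rightarrow> Md x x | _ \<Rightarrow> s)" for e
    by (cases e) (simp_all add: label entry_mat vals(3))
  define f where "f = s powi (- crossing_sign up k (D ! k)) *
    event_weight Mu Md (mat s) Rbar \<sigma> k (D ! k)"
  then have f: "f = s powi (- crossing_sign up k (D ! k)) *
      (case D ! k of Cup _ \<Rightarrow> Mu x x | Cap _ \<Rightarrow> Md x x | _ \<Rightarrow> s)"
    by (simp only: weights)
  have "s powi (- (\<Sum>t<Suc k. crossing_sign up t (D ! t))) *
         (\<Prod>t<Suc k. event_weight Mu Md (mat s) Rbar \<sigma> t (D ! t))
      = Mu x x ^ (width D k div 2) * f"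
    using Suc.IH k \<open>s \<noteq> 0\<close> by (simp add: f_def power_int_diff power_int_minus field_simps)
  also have "\<dots> = Mu x x ^ (width D (Suc k) div 2)"
  proof (cases "D ! k")
    case (Cup p)
    then show ?thesis
      using k by (simp add: f width_Suc)
  next
    case (Cap p)
    then have "width D k \<ge> 2"
      using ok k by fastforce
    then have "width D k div 2 = Suc (width D (Suc k) div 2)"
      using Cap k by (simp add: width_Suc)
    with vals(1) show ?thesis
      using Cap by (simp add: f)
  next
    case (Cross_R p)
    then show ?thesis
      using k vals(2) by (simp add: f width_Suc power_int_minus inv_s)
  next
    case (Cross_Rbar p)
    then show ?thesis
      using k vals(2) by (simp add: f width_Suc power_int_minus inv_s)
  qed
  finally show ?case .
qed

lemma normalized_state_sum_one_dimensional:
  fixes Mu Md :: "'n::finite \<Rightarrow> 'n \<Rightarrow> complex"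
  assumes "quantum_state_model Mu Md (mat s) Rbar" and "s \<noteq> 0" and "morse_diagram D"
  shows "normalized_state_sum s Mu Md (mat s) Rbar D up = 1"
proof -
  have "labellings D = {\<lambda>q \<in> points D. undefined :: 'n}"
    by (rule labellings_one_dimensional) (rule scalar_model_one_dimensional[OF assms(1,2)])
  then show ?thesis
    using normalized_product_below_level[OF assms(1,2), of D "length D" up
        "\<lambda>q \<in> points D. undefined" undefined] \<open>morse_diagram D\<close>
    by (simp add: normalized_state_sum_def state_sum_def writhe_def morse_diagram_def)
qed

lemma morse_diagram_circle: "morse_diagram circle_diagram"
  by (auto simp: morse_diagram_def circle_diagram_def width_def less_Suc_eq)

theorem theorem3p2:
  fixes Mu Md :: "'n::finite \<Rightarrow> 'n \<Rightarrow> complex"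
    and R Rbar :: "complex ^ ('n \<times> 'n) ^ ('n \<times> 'n)"
    and F G :: "complex ^ 'n ^ 'n"
    and s :: complex
    and K :: "event list"
    and up up\<^sub>O :: "nat \<times> nat \<Rightarrow> bool"
  assumes "quantum_state_model Mu Md R Rbar"
    and "invertible F" and "invertible G" and "R = tensor_op F G"
    and "s \<noteq> 0" and "R = mat s"
    and "knot_diagram K"
    and "orientation K up"
    and "orientation circle_diagram up\<^sub>O"
  shows "normalized_state_sum s Mu Md R Rbar K up =
         normalized_state_sum s Mu Md R Rbar circle_diagram up\<^sub>O"
proof -
  have "morse_diagram K"
    using \<open>knot_diagram K\<close> by (simp add: knot_diagram_def)
  then show ?thesis
    using assms(1) \<open>s \<noteq> 0\<close> morse_diagram_circle
    unfolding \<open>R = mat s\<close> by (simp add: normalized_state_sum_one_dimensional)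
qed

end
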